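(* Let $n$ be a positive integer, let $m_1,m_2,\dots,m_n$ be positive integers, and let $v$ be any odd integer with $v\ge\prod_{i=1}^{n}(m_i+1)$. Then there exists a $\bigl(v,\,2^n,\,\prod_{i=1}^{n}m_i\bigr)$ non-half-sum Latin rectangle (NHSLR). Consequently, for every positive integer $N$, there is a $2^nv$-division $(v,M,N)$ coded caching scheme (that is, with $K=v$ users and subpacketization $F=2^nv$) with memory ratio $M/N=1-\frac{\prod_{i=1}^{n}m_i}{v}$, coded caching gain $g=2^n$, and transmission load $R=\frac{\prod_{i=1}^{n}m_i}{2^n}$.
   Context: Notation: $[a]=\{1,\dots,a\}$; $\mathbb{Z}_v$ is the ring of integers modulo $v$. NHSLR. For a positive odd integer $v$ and positive integers $g,b$, a $g\times b$ array $\mathbf{D}$ with entries in $\mathbb{Z}_v$ is a $(v,g,b)$ NHSLR if: (i) each element of $\mathbb{Z}_v$ appears at most once in each row and at most once in each column of $\mathbf{D}$; (ii) for any two distinct rows $\mathbf{d},\mathbf{d}'$ of $\mathbf{D}$ (rows at two different row positions), no entry of the vector $\frac12(\mathbf{d}+\mathbf{d}')$ (computed entrywise in $\mathbb{Z}_v$, where $2$ is invertible since $v$ is odd) appears as an entry of $\mathbf{d}$ or of $\mathbf{d}'$. Coded caching. In a $(K,M,N)$ system a server holds $N$ equal-size files and is connected by an error-free shared (broadcast) link to $K$ users, each having a cache of size $M$ files ($0\le M\le N$). An $F$-division scheme (uncoded placement) has two phases. Placement: each file $W_n$ is split into $F$ equal-size packets $W_{n,1},\dots,W_{n,F}$ (bit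 strings of a common length), and each user caches some packets, of total size at most $M$ files, without knowing the demands. Delivery: given any demand vector $\mathbf{d}=(d_1,\dots,d_K)\in[N]^K$, the server broadcasts $R_{\mathbf d}F$ coded packets (XORs of packets) so that each user $k$ can recover $W_{d_k}$ from the broadcast and its cache. $F$ is the subpacketization, $M/N$ the memory ratio, and the load is $R=\max_{\mathbf d}R_{\mathbf d}$. The scheme has coded caching gain $g$ if each broadcast coded packet is an XOR of $g$ packets requested by $g$ different users, each of whom can decode its own requested packet from it using its cache. PDA and the associated scheme. An $F\times K$ array $\mathbf{P}=(p_{j,k})$ with entries in $\{*\}\cup[S]$ (or any symbol set of size $S$ in place of $[S]$) is a $(K,F,Z,S)$ placement delivery array (PDA) if: C1. each column contains exactly $Z$ stars; C2. each of the $S$ non-star symbols occurs at least once; C3. whenever two distinct positions $(j_1,k_1)\ne(j_2,k_2)$ satisfy $p_{j_1,k_1}=p_{j_2,k_2}\neq *$, then $j_1\ne j_2$, $k_1\ne k_2$ and $p_{j_1,k_2}=p_{j_2,k_1}=*$. It realizes the $F$-division scheme in which user $k$ caches packet $j$ of every file exactly when $p_{j,k}=*$, and for every non-star symbol $s$ the server sends $\bigoplus_{(j,k):\,p_{j,k}=s}W_{d_k,j}$; thus $M/N=Z/F$, $R=S/F$, and the gain is $g$ when each symbol occurs exactly $g$ times. *)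

theory Defs
  imports Complex_Main "HOL-Number_Theory.Number_Theory" "HOL-Library.FuncSet" "HOL-Library.Z2"
begin

section \<open>Non-half-sum Latin rectangles\<close>

text \<open>
  The elements of the ring of integers modulo \<open>v\<close> are represented by their residues
  in \<open>{0..<v}\<close>; a \<open>g\<close> by \<open>b\<close> array is a function of a row index \<open>i < g\<close> and a column index
  \<open>j < b\<close>.
\<close>

definition half_sum :: "nat \<Rightarrow> int \<Rightarrow> int \<Rightarrow> int" where
  "half_sum v x y = (modular_inverse (int v) 2 * (x + y)) mod int v"

definition NHSLR :: "nat \<Rightarrow> nat \<Rightarrow> nat \<Rightarrow> (nat \<Rightarrow> nat \<Rightarrow> int) \<Rightarrow> bool" where
  "NHSLR v g b D \<longleftrightarrow>
     odd v \<and> g > 0 \<and> b > 0 \<and>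
     (\<forall>i<g. \<forall>j<b. D i j \<in> {0..<int v}) \<and>
     (\<forall>i<g. inj_on (\<lambda>j. D i j) {..<b}) \<and>
     (\<forall>j<b. inj_on (\<lambda>i. D i j) {..<g}) \<and>
     (\<forall>i<g. \<forall>i'<g. i \<noteq> i' \<longrightarrow>
        (\<forall>j<b. half_sum v (D i j) (D i' j) \<notin> D i ` {..<b} \<union> D i' ` {..<b}))"

section \<open>Coded caching with uncoded placement\<close>

text \<open>
  Files, packets and users are numbered from \<open>0\<close>. The pair \<open>(f, j)\<close> denotes packet
  \<open>j < F\<close> of file \<open>f < N\<close>; a library assigns to every such pair a string of \<open>L\<close> bits.
\<close>

type_synonym packet = "nat \<times> nat"
type_synonym contents = "packet \<Rightarrow> bit list"

definition packets :: "nat \<Rightarrow> nat \<Rightarrow> packet set" where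
  "packets N F = {..<N} \<times> {..<F}"

definition libraries :: "nat \<Rightarrow> nat \<Rightarrow> nat \<Rightarrow> contents set" where
  "libraries N F L = {W. \<forall>p\<in>packets N F. length (W p) = L}"

definition file_of :: "nat \<Rightarrow> contents \<Rightarrow> nat \<Rightarrow> bit list" where
  "file_of F W f = concat (map (\<lambda>j. W (f, j)) [0..<F])"

text \<open>Addition of the type \<^typ>\<open>bit\<close> is exclusive or.\<close>

definition xor_packets :: "nat \<Rightarrow> contents \<Rightarrow> packet set \<Rightarrow> bit list" where
  "xor_packets L W X = map (\<lambda>t. \<Sum>p\<in>X. W p ! t) [0..<L]"

definition cache_content :: "contents \<Rightarrow> packet set \<Rightarrow> packet \<Rightarrow> bit list option" where
  "cache_content W A p = (if p \<in> A then Some (W p) else None)"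

text \<open>
  The decoding function may depend on the scheme, the demands and the user, all of which are
  fixed inside \<open>observed\<close> and \<open>wanted\<close>, but not on the library.
\<close>

definition recoverable ::
  "nat \<Rightarrow> nat \<Rightarrow> nat \<Rightarrow> (contents \<Rightarrow> 'o) \<Rightarrow> (contents \<Rightarrow> 'w) \<Rightarrow> bool" where
  "recoverable N F L observed wanted \<longleftrightarrow>
     (\<exists>decode. \<forall>W\<in>libraries N F L. decode (observed W) = wanted W)"

definition demands :: "nat \<Rightarrow> nat \<Rightarrow> (nat \<Rightarrow> nat) set" where
  "demands K N = {..<K} \<rightarrow>\<^sub>E {..<N}"

text \<open>
  A scheme is given by the set \<open>cache k\<close> of packets stored by each user \<open>k\<close>, chosen before
  the demands, and by the list \<open>send d\<close> of coded packets broadcast for the demand vector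
  \<open>d\<close>, each coded packet being described by the set of packets that are XORed. A cache of
  size \<open>M\<close> files has room for \<open>M * F\<close> packets. The placement and the delivery
  do not depend on the packet length \<open>L\<close>.
\<close>

definition coded_caching_scheme ::
  "nat \<Rightarrow> nat \<Rightarrow> real \<Rightarrow> nat \<Rightarrow> (nat \<Rightarrow> packet set) \<Rightarrow> ((nat \<Rightarrow> nat) \<Rightarrow> packet set list) \<Rightarrow> bool"
where
  "coded_caching_scheme F K M N cache send \<longleftrightarrow>
     F > 0 \<and> K > 0 \<and> N > 0 \<and> 0 \<le> M \<and> M \<le> real N \<and>
     (\<forall>k<K. cache k \<subseteq> packets N F \<and> real (card (cache k)) \<le> M * real F) \<and>
     (\<forall>d\<in>demands K N.
        (\<forall>X\<in>set (send d). X \<subseteq> packets N F) \<and>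
        (\<forall>k<K. \<forall>L. recoverable N F L
           (\<lambda>W. (map (xor_packets L W) (send d), cache_content W (cache k)))
           (\<lambda>W. file_of F W (d k))))"

definition load :: "nat \<Rightarrow> nat \<Rightarrow> nat \<Rightarrow> ((nat \<Rightarrow> nat) \<Rightarrow> packet set list) \<Rightarrow> real" where
  "load F K N send = Max ((\<lambda>d. real (length (send d)) / real F) ` demands K N)"

text \<open>
  In the following, \<open>u\<close> assigns to each packet \<open>p\<close> of a coded packet the user
  requesting it: \<open>p\<close> belongs to the file demanded by \<open>u p\<close> and is not in the cache of
  \<open>u p\<close>.
\<close>

definition coded_caching_gain ::
  "nat \<Rightarrow> nat \<Rightarrow> nat \<Rightarrow> (nat \<Rightarrow> packet set) \<Rightarrow> ((nat \<Rightarrow> nat) \<Rightarrow> packet set list) \<Rightarrow> nat \<Rightarrow> bool"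
where
  "coded_caching_gain F K N cache send g \<longleftrightarrow>
     (\<forall>d\<in>demands K N. \<forall>X\<in>set (send d).
        card X = g \<and>
        (\<exists>u. inj_on u X \<and>
           (\<forall>p\<in>X. u p < K \<and> fst p = d (u p) \<and> p \<notin> cache (u p) \<and>
              (\<forall>L. recoverable N F L
                 (\<lambda>W. (xor_packets L W X, cache_content W (cache (u p))))
                 (\<lambda>W. W p)))))"

end

theory Submission
  imports Defs
begin

text \<open>
  The rows of the rectangle are indexed by sign vectors \<open>\<sigma>\<close>, the columns by digit vectors \<open>x\<close>
  with \<open>1 \<le> x i \<le> m i\<close>, and the entry is the signed mixed-radix sum of \<open>\<sigma> i * x i\<close> with weights
  \<open>(m 1 + 1) * \<dots> * (m (i - 1) + 1)\<close>. The half-sum of the entries of a column in two rows \<open>\<sigma>\<close> and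
  \<open>\<sigma>'\<close> is the same sum with the digits at the positions where \<open>\<sigma>\<close> and \<open>\<sigma>'\<close> differ replaced by
  \<open>0\<close>. Since \<open>v \<ge> (m 1 + 1) * \<dots> * (m n + 1)\<close>, digits between \<open>0\<close> and \<open>m i\<close> are determined by the sum
  modulo \<open>v\<close>, whereas the entries of the rectangle have no digit \<open>0\<close>.

  A rectangle \<open>D\<close> gives a placement delivery array with rows \<open>(i, f)\<close> and columns \<open>k\<close>: the cell is
  a star unless \<open>k - f\<close> is an entry \<open>D i j\<close>, and then it carries the symbol \<open>(f + k, j)\<close>. Two cells
  \<open>(i, f), k\<close> and \<open>(i', f'), k'\<close> with the same symbol have \<open>k' - f = (D i j + D i' j) / 2\<close>, so
  the crossing cells are stars by the half-sum condition.
\<close>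

section \<open>Mixed-radix sums with signed digits\<close>

definition radix_weight :: "(nat \<Rightarrow> nat) \<Rightarrow> nat \<Rightarrow> int" where
  "radix_weight m i = (\<Prod>l=1..<i. int (m l) + 1)"

text \<open>The weight of each position is the product of the \<open>m l + 1\<close> below it, which
  bounds strictly what the lower digits can contribute. A top digit adds at most
  \<open>m (Suc n)\<close> further copies of this bound.\<close>

lemma radix_sum_bound:
  assumes "\<And>i. i \<in> {1..n} \<Longrightarrow> \<bar>c i\<bar> \<le> int (m i)"
  shows "\<bar>\<Sum>i=1..n. c i * radix_weight m i\<bar> < (\<Prod>i=1..n. int (m i) + 1)"
  using assms
proof (induction n)
  case (Suc n)
  let ?S = "\<Sum>i=1..n. c i * radix_weight m i"
  let ?B = "\<Prod>i=1..n. int (m i) + 1"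
  have IH: "\<bar>?S\<bar> < ?B" using Suc by auto
  have w: "radix_weight m (Suc n) = ?B"
    by (simp add: radix_weight_def atLeastLessThanSuc_atLeastAtMost)
  have "\<bar>c (Suc n) * ?B\<bar> \<le> int (m (Suc n)) * ?B"
    unfolding abs_mult using IH Suc.prems[of "Suc n"] by (intro mult_mono) auto
  then show ?case using IH by (simp add: w algebra_simps)
qed simp

text \<open>A nonzero top digit contributes at least the full weight in absolute value, which the
  lower digits cannot cancel. The digits may be negative, so the lemma applies to differences of
  expansions.\<close>

lemma radix_sum_eq_0D:
  assumes "\<And>i. i \<in> {1..n} \<Longrightarrow> \<bar>c i\<bar> \<le> int (m i)"
    and "(\<Sum>i=1..n. c i * radix_weight m i) = 0" and "i \<in> {1..n}"
  shows "c i = 0"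
  using assms
proof (induction n arbitrary: i)
  case (Suc n)
  let ?S = "\<Sum>i=1..n. c i * radix_weight m i"
  let ?B = "\<Prod>i=1..n. int (m i) + 1"
  have bound: "\<bar>?S\<bar> < ?B" using Suc.prems by (intro radix_sum_bound) auto
  have w: "radix_weight m (Suc n) = ?B"
    by (simp add: radix_weight_def atLeastLessThanSuc_atLeastAtMost)
  have sum: "?S + c (Suc n) * ?B = 0" using Suc.prems(2) by (simp add: w)
  have top: "c (Suc n) = 0"
  proof (rule ccontr)
    assume "c (Suc n) \<noteq> 0"
    then have "1 * ?B \<le> \<bar>c (Suc n)\<bar> * ?B" using bound by (intro mult_right_mono) auto
    also have "\<dots> = \<bar>c (Suc n) * ?B\<bar>" using bound by (simp add: abs_mult)
    also have "\<dots> = \<bar>?S\<bar>" using sum by linarith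
    finally show False using bound by simp
  qed
  show ?case
  proof (cases "i = Suc n")
    case False
    then show ?thesis using Suc.prems sum top by (intro Suc.IH) auto
  qed (simp add: top)
qed simp

text \<open>Here the lower bound on \<open>v\<close> enters: the sum is smaller than
  \<open>v\<close> in absolute value, so divisibility by \<open>v\<close> makes it vanish. All three
  conditions on the rectangle are reduced to this lemma.\<close>

lemma radix_sum_dvdD:
  assumes "\<And>i. i \<in> {1..n} \<Longrightarrow> \<bar>c i\<bar> \<le> int (m i)"
    and "(\<Prod>i=1..n. m i + 1) \<le> v"
    and "int v dvd (\<Sum>i=1..n. c i * radix_weight m i)" and "i \<in> {1..n}"
  shows "c i = 0"
proof -
  have "\<bar>\<Sum>i=1..n. c i * radix_weight m i\<bar> < (\<Prod>i=1..n. int (m i) + 1)"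
    using assms(1) by (rule radix_sum_bound)
  also have "\<dots> = int (\<Prod>i=1..n. m i + 1)" by (simp add: add.commute)
  also have "\<dots> \<le> int v" using assms(2) by (simp only: of_nat_le_iff)
  finally have "\<not> \<bar>int v\<bar> \<le> \<bar>\<Sum>i=1..n. c i * radix_weight m i\<bar>" by linarith
  then have "(\<Sum>i=1..n. c i * radix_weight m i) = 0"
    using assms(3) dvd_imp_le_int by blast
  then show ?thesis using radix_sum_eq_0D assms(1,4) by blast
qed

section \<open>The Latin rectangle\<close>

text \<open>Doubling undoes the modular inverse of 2, so later arguments can work with congruences
  for twice the half-sum.\<close>

lemma cong_double_half_sum:
  assumes "odd v"
  shows "[2 * half_sum v x y = x + y] (mod int v)"
proof -
  have "coprime 2 (int v)" using assms by simp
  then have "[2 * modular_inverse (int v) 2 = 1] (mod int v)"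
    by (metis cong_modular_inverse1)
  then have "[2 * modular_inverse (int v) 2 * (x + y) = 1 * (x + y)] (mod int v)"
    by (intro cong_mult) auto
  then show ?thesis
    unfolding half_sum_def cong_def by (simp add: mod_mult_right_eq mult.assoc)
qed

lemma half_sum_commute: "half_sum v x y = half_sum v y x"
  by (simp add: half_sum_def add.commute)

definition signed_radix :: "nat \<Rightarrow> (nat \<Rightarrow> nat) \<Rightarrow> (nat \<Rightarrow> int) \<Rightarrow> (nat \<Rightarrow> int) \<Rightarrow> int" where
  "signed_radix n m \<sigma> x = (\<Sum>i=1..n. \<sigma> i * x i * radix_weight m i)"

lemma NHSLR_exists:
  assumes pos: "\<And>i. i \<in> {1..n} \<Longrightarrow> m i > 0"
    and "odd v" and v: "(\<Prod>i=1..n. m i + 1) \<le> v"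
  shows "\<exists>D. NHSLR v (2 ^ n) (\<Prod>i=1..n. m i) D"
proof -
  define signs where "signs = {1..n} \<rightarrow>\<^sub>E {-1, 1::int}"
  define digits where "digits = (\<Pi>\<^sub>E i\<in>{1..n}. {1..int (m i)})"
  let ?b = "\<Prod>i=1..n. m i"
  have "card signs = 2 ^ n" by (simp add: signs_def card_PiE numeral_2_eq_2)
  \<comment> \<open>Any numbering of the sign vectors, and below of the digit vectors, will do; only
    bijectivity matters.\<close>
  then obtain \<rho> where \<rho>: "bij_betw \<rho> {..<2 ^ n :: nat} signs"
    using finite_same_card_bij[of "{..<2 ^ n::nat}" signs]
    by (auto simp: signs_def intro!: finite_PiE)
  have "card digits = ?b" by (simp add: digits_def card_PiE)
  then obtain \<kappa> where \<kappa>: "bij_betw \<kappa> {..<?b} digits"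
    using finite_same_card_bij[of "{..<?b}" digits]
    by (auto simp: digits_def intro!: finite_PiE)
  have sign: "\<rho> i l \<in> {-1, 1}" if "i < 2 ^ n" "l \<in> {1..n}" for i l
    using that bij_betwE[OF \<rho>] by (force simp: signs_def PiE_iff)
  have digit: "1 \<le> \<kappa> j l \<and> \<kappa> j l \<le> int (m l)" if "j < ?b" "l \<in> {1..n}" for j l
    using that bij_betwE[OF \<kappa>] by (force simp: digits_def PiE_iff)
  have sign_diff: "\<exists>l\<in>{1..n}. \<rho> i l \<noteq> \<rho> i' l" if "i < 2 ^ n" "i' < 2 ^ n" "i \<noteq> i'" for i i'
  proof (rule ccontr)
    assume "\<not> ?thesis"
    then have "\<rho> i = \<rho> i'"
      using that bij_betwE[OF \<rho>] unfolding signs_def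
      by (intro PiE_ext[of _ "{1..n}" "\<lambda>_. {-1, 1}"]) auto
    then show False using that bij_betw_imp_inj_on[OF \<rho>] by (simp add: inj_on_eq_iff)
  qed
  define D where "D i j = signed_radix n m (\<rho> i) (\<kappa> j) mod int v" for i j
  have rows: "inj_on (D i) {..<?b}" if i: "i < 2 ^ n" for i
  proof (rule inj_onI)
    fix j j' assume j: "j \<in> {..<?b}" "j' \<in> {..<?b}" and "D i j = D i j'"
    then have "int v dvd signed_radix n m (\<rho> i) (\<kappa> j) - signed_radix n m (\<rho> i) (\<kappa> j')"
      by (simp add: D_def mod_eq_dvd_iff)
    \<comment> \<open>Within a row the signs are shared, so the difference of two entries has the
      digit differences, up to sign, as its digits.\<close>
    then have dvd: "int v dvd (\<Sum>l=1..n. (\<rho> i l * (\<kappa> j l - \<kappa> j' l)) * radix_weight m l)"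
      by (simp add: signed_radix_def sum_subtractf[symmetric] algebra_simps)
    have "\<rho> i l * (\<kappa> j l - \<kappa> j' l) = 0" if "l \<in> {1..n}" for l
    proof (rule radix_sum_dvdD[OF _ v dvd that])
      fix l assume "l \<in> {1..n}"
      then show "\<bar>\<rho> i l * (\<kappa> j l - \<kappa> j' l)\<bar> \<le> int (m l)"
        using sign[OF i] digit[of j l] digit[of j' l] j by fastforce
    qed
    then have "\<kappa> j l = \<kappa> j' l" if "l \<in> {1..n}" for l
      using sign[OF i] that by fastforce
    then have "\<kappa> j = \<kappa> j'"
      using j bij_betwE[OF \<kappa>] unfolding digits_def
      by (intro PiE_ext[of _ "{1..n}" "\<lambda>i. {1..int (m i)}"]) auto
    then show "j = j'" using j bij_betw_imp_inj_on[OF \<kappa>] by (simp add: inj_on_eq_iff)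
  qed
  have cols: "inj_on (\<lambda>i. D i j) {..<2 ^ n}" if j: "j < ?b" for j
  proof (rule inj_onI, rule ccontr)
    fix i i' :: nat assume i: "i \<in> {..<2 ^ n}" "i' \<in> {..<2 ^ n}" and eq: "D i j = D i' j" and "i \<noteq> i'"
    then obtain l where l: "l \<in> {1..n}" "\<rho> i l \<noteq> \<rho> i' l" using sign_diff[of i i'] by blast
    \<comment> \<open>Signs differ by -2, 0 or 2, so the difference of the entries is twice a radix
      sum with digits \<open>c\<close>. Cancelling the 2, possible as \<open>v\<close> is odd,
      brings the digits within the bounds \<open>m l\<close>.\<close>
    define c where "c l = (\<rho> i l - \<rho> i' l) div 2 * \<kappa> j l" for l
    have c: "\<rho> i l * \<kappa> j l - \<rho> i' l * \<kappa> j l = 2 * c l" if "l \<in> {1..n}" for l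
      using sign[of i l] sign[of i' l] i that by (auto simp: c_def)
    have "signed_radix n m (\<rho> i) (\<kappa> j) - signed_radix n m (\<rho> i') (\<kappa> j)
        = 2 * (\<Sum>l=1..n. c l * radix_weight m l)"
      unfolding signed_radix_def sum_distrib_left sum_subtractf[symmetric]
      using c by (intro sum.cong) (auto simp flip: mult.assoc left_diff_distrib)
    moreover have "int v dvd signed_radix n m (\<rho> i) (\<kappa> j) - signed_radix n m (\<rho> i') (\<kappa> j)"
      using eq by (simp add: D_def mod_eq_dvd_iff)
    ultimately have dvd: "int v dvd (\<Sum>l=1..n. c l * radix_weight m l)"
      using \<open>odd v\<close> by (simp add: coprime_dvd_mult_right_iff)
    have "c l = 0"
    proof (rule radix_sum_dvdD[OF _ v dvd l(1)])
      fix l assume "l \<in> {1..n}"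
      then show "\<bar>c l\<bar> \<le> int (m l)"
        using sign[of i l] sign[of i' l] i digit[OF j, of l] by (auto simp: c_def)
    qed
    then show False using c[OF l(1)] l digit[OF j l(1)] by auto
  qed
  have half: "half_sum v (D i j) (D i' j) \<noteq> D i k"
    if lt: "i < 2 ^ n" "i' < 2 ^ n" "i \<noteq> i'" "j < ?b" "k < ?b" for i i' j k
  proof
    assume eq: "half_sum v (D i j) (D i' j) = D i k"
    obtain l where l: "l \<in> {1..n}" "\<rho> i l \<noteq> \<rho> i' l" using sign_diff[OF lt(1-3)] by blast
    \<comment> \<open>These are the digits of the entry minus those of the half-sum. Where the signs
      agree, \<open>c l\<close> is a digit difference up to sign; where they differ, the mean sign
      is 0 and \<open>c l\<close> has absolute value \<open>\<kappa> k l\<close>, which is at least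
      1.\<close>
    define c where "c l = \<rho> i l * \<kappa> k l - (\<rho> i l + \<rho> i' l) div 2 * \<kappa> j l" for l
    have c: "2 * (\<rho> i l * \<kappa> k l) - (\<rho> i l * \<kappa> j l + \<rho> i' l * \<kappa> j l) = 2 * c l"
      if "l \<in> {1..n}" for l
      using sign[of i l] sign[of i' l] lt that by (auto simp: c_def)
    have "2 * signed_radix n m (\<rho> i) (\<kappa> k)
        - (signed_radix n m (\<rho> i) (\<kappa> j) + signed_radix n m (\<rho> i') (\<kappa> j))
        = 2 * (\<Sum>l=1..n. c l * radix_weight m l)"
      unfolding signed_radix_def sum_distrib_left sum_subtractf[symmetric] sum.distrib[symmetric]
      using c by (intro sum.cong)
        (auto simp flip: mult.assoc left_diff_distrib distrib_right)
    moreover have "[2 * D i k = D i j + D i' j] (mod int v)"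
      using cong_double_half_sum[OF \<open>odd v\<close>] eq by metis
    then have "[2 * signed_radix n m (\<rho> i) (\<kappa> k)
        = signed_radix n m (\<rho> i) (\<kappa> j) + signed_radix n m (\<rho> i') (\<kappa> j)] (mod int v)"
      by (simp add: D_def cong_def mod_simps)
    ultimately have dvd: "int v dvd (\<Sum>l=1..n. c l * radix_weight m l)"
      using \<open>odd v\<close> by (simp add: cong_iff_dvd_diff coprime_dvd_mult_right_iff)
    have "c l = 0"
    proof (rule radix_sum_dvdD[OF _ v dvd l(1)])
      fix l assume "l \<in> {1..n}"
      then show "\<bar>c l\<bar> \<le> int (m l)"
        using sign[of i l] sign[of i' l] lt digit[of j l] digit[of k l]
        by (auto simp: c_def)
    qed
    then show False
      using sign[of i l] sign[of i' l] lt l digit[of k l] by (auto simp: c_def)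
  qed
  have "half_sum v (D i j) (D i' j) \<notin> D i ` {..<?b} \<union> D i' ` {..<?b}"
    if "i < 2 ^ n" "i' < 2 ^ n" "i \<noteq> i'" "j < ?b" for i i' j
    using half[OF that] half[OF that(2,1) that(3)[symmetric] that(4)]
    by (auto simp: half_sum_commute[of v "D i' j" "D i j"])
  moreover have "?b > 0" using pos by (intro prod_pos) auto
  moreover have "v > 0" using \<open>odd v\<close> by (rule odd_pos)
  ultimately have "NHSLR v (2 ^ n) ?b D"
    using \<open>odd v\<close> rows cols unfolding NHSLR_def by (auto simp: D_def)
  then show ?thesis by blast
qed

section \<open>Placement delivery arrays\<close>

text \<open>A decoder may return the wanted data of any library with the given observation; this is
  correct exactly when the observation determines that data. Decoding thus becomes a comparison of
  two libraries.\<close>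

lemma recoverable_iff:
  "recoverable N F L observed wanted \<longleftrightarrow>
     (\<forall>W\<in>libraries N F L. \<forall>W'\<in>libraries N F L. observed W = observed W' \<longrightarrow> wanted W = wanted W')"
  (is "_ \<longleftrightarrow> ?R")
proof
  assume ?R
  then have "wanted (inv_into (libraries N F L) observed (observed W)) = wanted W"
    if "W \<in> libraries N F L" for W
    using that by (metis f_inv_into_f image_eqI inv_into_into)
  then show "recoverable N F L observed wanted"
    unfolding recoverable_def by (intro exI[of _ "wanted \<circ> inv_into (libraries N F L) observed"]) auto
qed (metis recoverable_def)

lemma xor_packets_cancel:
  assumes "W \<in> libraries N F L" "W' \<in> libraries N F L" "X \<subseteq> packets N F" "p \<in> X"
    and xor: "xor_packets L W X = xor_packets L W' X"
    and others: "\<And>q. q \<in> X - {p} \<Longrightarrow> W q = W' q"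
  shows "W p = W' p"
proof (rule nth_equalityI)
  have "p \<in> packets N F" using assms by auto
  then have len: "length (W p) = L" "length (W' p) = L" using assms by (auto simp: libraries_def)
  then show "length (W p) = length (W' p)" by simp
  have "finite X" using assms(3) by (rule finite_subset) (simp add: packets_def)
  fix t assume "t < length (W p)"
  then have "(\<Sum>q\<in>X. W q ! t) = (\<Sum>q\<in>X. W' q ! t)"
    using xor len by (auto simp: xor_packets_def)
  moreover have "(\<Sum>q\<in>X - {p}. W q ! t) = (\<Sum>q\<in>X - {p}. W' q ! t)"
    using others by (intro sum.cong) auto
  ultimately show "W p ! t = W' p ! t"
    using \<open>finite X\<close> \<open>p \<in> X\<close> by (metis add_right_cancel sum.remove)
qed

text \<open>The star of an array is represented by \<^const>\<open>None\<close>.\<close>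

locale pda =
  fixes K F Z :: nat and S :: "'s set" and P :: "nat \<Rightarrow> nat \<Rightarrow> 's option"
  assumes stars: "k < K \<Longrightarrow> card {j. j < F \<and> P j k = None} = Z"
    and entry: "j < F \<Longrightarrow> k < K \<Longrightarrow> P j k = Some s \<Longrightarrow> s \<in> S"
    and occurs: "s \<in> S \<Longrightarrow> \<exists>j<F. \<exists>k<K. P j k = Some s"
    and distinct_entries:
      "j < F \<Longrightarrow> j' < F \<Longrightarrow> k < K \<Longrightarrow> k' < K \<Longrightarrow> (j, k) \<noteq> (j', k') \<Longrightarrow>
       P j k = Some s \<Longrightarrow> P j' k' = Some s \<Longrightarrow>
       j \<noteq> j' \<and> k \<noteq> k' \<and> P j k' = None \<and> P j' k = None"
begin

section \<open>Decoding, memory and gain for an array\<close>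

definition positions :: "'s \<Rightarrow> (nat \<times> nat) set" where
  "positions s = {(j, k). j < F \<and> k < K \<and> P j k = Some s}"

definition cached :: "nat \<Rightarrow> nat \<Rightarrow> packet set" where
  "cached N k = {..<N} \<times> {j. j < F \<and> P j k = None}"

definition coded :: "(nat \<Rightarrow> nat) \<Rightarrow> 's \<Rightarrow> packet set" where
  "coded d s = (\<lambda>(j, k). (d k, j)) ` positions s"

lemma coded_subset: "d \<in> demands K N \<Longrightarrow> coded d s \<subseteq> packets N F"
  by (auto simp: coded_def positions_def demands_def packets_def PiE_iff)

text \<open>Any other cell \<open>(j', k')\<close> with symbol \<open>s\<close> has a star at
  \<open>(j', k)\<close>, so user \<open>k\<close> has cached every packet of the XOR except its own
  and can cancel them.\<close>

lemma coded_decodable: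
  assumes d: "d \<in> demands K N" and pos: "(j, k) \<in> positions s"
    and W: "W \<in> libraries N F L" "W' \<in> libraries N F L"
    and xor: "xor_packets L W (coded d s) = xor_packets L W' (coded d s)"
    and cache: "cache_content W (cached N k) = cache_content W' (cached N k)"
  shows "W (d k, j) = W' (d k, j)"
proof (rule xor_packets_cancel[OF W coded_subset[OF d] _ xor])
  show "(d k, j) \<in> coded d s" using pos by (force simp: coded_def)
  fix q assume q: "q \<in> coded d s - {(d k, j)}"
  then obtain j' k' where q': "q = (d k', j')" "(j', k') \<in> positions s" by (auto simp: coded_def)
  then have "P j' k = None"
    using q pos distinct_entries[of j j' k k' s] by (auto simp: positions_def)
  then have "q \<in> cached N k"
    using q' d by (auto simp: cached_def positions_def demands_def PiE_iff)
  then show "W q = W' q"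
    using fun_cong[OF cache, of q] by (simp add: cache_content_def)
qed

text \<open>A star in column \<open>k\<close> means that the packet is read from the cache; any
  other cell names the coded packet from which it is decoded.\<close>

lemma scheme:
  assumes "F > 0" "K > 0" "N > 0" and ss: "set ss = S"
  shows "coded_caching_scheme F K (real N * (real Z / real F)) N (cached N)
           (\<lambda>d. map (coded d) ss)"
proof -
  have "Z \<le> F"
    using stars[OF \<open>K > 0\<close>] card_mono[of "{..<F}" "{j. j < F \<and> P j 0 = None}"] by auto
  moreover have "real N * (real Z / real F) \<le> real N * 1"
    using \<open>Z \<le> F\<close> by (intro mult_left_mono) (auto simp: divide_le_eq)
  moreover have "real (card (cached N k)) \<le> real N * (real Z / real F) * real F" if "k < K" for k
    using stars[OF that] \<open>F > 0\<close> by (simp add: cached_def card_cartesian_product)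
  moreover have "cached N k \<subseteq> packets N F" for k
    by (auto simp: cached_def packets_def)
  moreover have "recoverable N F L
      (\<lambda>W. (map (xor_packets L W) (map (coded d) ss), cache_content W (cached N k)))
      (\<lambda>W. file_of F W (d k))"
    if d: "d \<in> demands K N" and k: "k < K" for d k L
    unfolding recoverable_iff
  proof (intro ballI impI)
    fix W W' assume W: "W \<in> libraries N F L" "W' \<in> libraries N F L"
    assume "(map (xor_packets L W) (map (coded d) ss), cache_content W (cached N k))
      = (map (xor_packets L W') (map (coded d) ss), cache_content W' (cached N k))"
    then have xor: "\<And>s. s \<in> S \<Longrightarrow> xor_packets L W (coded d s) = xor_packets L W' (coded d s)"
      and cache: "cache_content W (cached N k) = cache_content W' (cached N k)"
      using ss by auto
    have "W (d k, j) = W' (d k, j)" if "j < F" for j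
    proof (cases "P j k")
      case None
      then have "(d k, j) \<in> cached N k"
        using that d k by (auto simp: cached_def demands_def PiE_iff)
      then show ?thesis
        using fun_cong[OF cache, of "(d k, j)"] by (simp add: cache_content_def)
    next
      case (Some s)
      then show ?thesis
        using that k entry xor cache
        by (intro coded_decodable[OF d _ W, of j k s]) (auto simp: positions_def)
    qed
    then show "file_of F W (d k) = file_of F W' (d k)"
      unfolding file_of_def by (intro arg_cong[of _ _ concat]) auto
  qed
  ultimately show ?thesis
    using assms coded_subset unfolding coded_caching_scheme_def by auto
qed

lemma gain:
  assumes ss: "set ss = S" and regular: "\<And>s. s \<in> S \<Longrightarrow> card (positions s) = g"
  shows "coded_caching_gain F K N (cached N) (\<lambda>d. map (coded d) ss) g"
  unfolding coded_caching_gain_def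
proof (intro ballI)
  fix d X assume d: "d \<in> demands K N" and "X \<in> set (map (coded d) ss)"
  then obtain s where s: "s \<in> S" "X = coded d s" using ss by auto
  have row_inj: "k = k'" if "(j, k) \<in> positions s" "(j, k') \<in> positions s" for j k k'
    using that distinct_entries[of j j k k' s] by (auto simp: positions_def)
  have col_inj: "j = j'" if "(j, k) \<in> positions s" "(j', k) \<in> positions s" for j j' k
    using that distinct_entries[of j j' k k s] by (auto simp: positions_def)
  \<comment> \<open>Several users may demand the same file, but cells with a common symbol lie in
    different rows, so their packets remain distinct.\<close>
  have "inj_on (\<lambda>(j, k). (d k, j)) (positions s)"
    using row_inj by (auto simp: inj_on_def)
  then have "card X = g" using s regular by (simp add: coded_def card_image)
  \<comment> \<open>The packet index is the array row, which contains only one cell with symbol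
    \<open>s\<close>; its column is the requesting user.\<close>
  moreover define u where "u p = (THE k. (snd p, k) \<in> positions s)" for p :: packet
  have u: "u (f, j) = k" if "(j, k) \<in> positions s" for f j k
    using that row_inj by (auto simp: u_def)
  have "inj_on u X"
    using u col_inj s by (auto simp: inj_on_def coded_def)
  moreover have "u p < K \<and> fst p = d (u p) \<and> p \<notin> cached N (u p) \<and>
      (\<forall>L. recoverable N F L (\<lambda>W. (xor_packets L W X, cache_content W (cached N (u p)))) (\<lambda>W. W p))"
    if "p \<in> X" for p
  proof -
    obtain j k where p: "p = (d k, j)" and pos: "(j, k) \<in> positions s"
      using \<open>p \<in> X\<close> s by (auto simp: coded_def)
    then have "u p = k" using u by simp
    then show ?thesis
      using p pos coded_decodable[OF d pos] s
      by (auto simp: recoverable_iff cached_def positions_def)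
  qed
  ultimately show "card X = g \<and> (\<exists>u. inj_on u X \<and> (\<forall>p\<in>X. u p < K \<and> fst p = d (u p) \<and>
      p \<notin> cached N (u p) \<and> (\<forall>L. recoverable N F L
        (\<lambda>W. (xor_packets L W X, cache_content W (cached N (u p)))) (\<lambda>W. W p))))"
    by blast
qed

end

text \<open>The demand set is nonempty, so \<open>Max\<close> is taken over a singleton.\<close>

lemma load_constant:
  assumes "N > 0" and "\<And>d. d \<in> demands K N \<Longrightarrow> length (send d) = l"
  shows "load F K N send = real l / real F"
proof -
  have "demands K N \<noteq> {}" using \<open>N > 0\<close> by (auto simp: demands_def PiE_eq_empty_iff)
  then have "(\<lambda>d. real (length (send d)) / real F) ` demands K N = {real l / real F}"
    using assms(2) by auto
  then show ?thesis by (simp add: load_def)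
qed

section \<open>From rectangles to arrays\<close>

text \<open>Row \<open>r\<close> stands for the pair of the rectangle row \<open>r div v\<close> and the residue \<open>r mod v\<close>.\<close>

definition NHSLR_array ::
  "nat \<Rightarrow> nat \<Rightarrow> (nat \<Rightarrow> nat \<Rightarrow> int) \<Rightarrow> nat \<Rightarrow> nat \<Rightarrow> (int \<times> nat) option" where
  "NHSLR_array v b D r k =
     (let x = (int k - int (r mod v)) mod int v; i = r div v in
      if x \<in> D i ` {..<b}
      then Some ((int k + int (r mod v)) mod int v, inv_into {..<b} (D i) x) else None)"

lemma less_mult_pairE:
  fixes r g v :: nat
  assumes "r < g * v"
  obtains i f where "r = i * v + f" "i < g" "f < v"
proof
  show "r = (r div v) * v + r mod v" by simp
  show "r div v < g" using assms by (simp add: less_mult_imp_div_less)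
  show "r mod v < v" using assms by (cases "v = 0") auto
qed

context
  fixes v g b :: nat and D :: "nat \<Rightarrow> nat \<Rightarrow> int"
  assumes D: "NHSLR v g b D"
begin

section \<open>Verification of the array conditions\<close>

lemma v_pos: "v > 0" and v_odd: "odd v"
  using D odd_pos by (auto simp: NHSLR_def)

lemma array_eq_Some_iff:
  assumes "i < g" "f < v"
  shows "NHSLR_array v b D (i * v + f) k = Some (c, j) \<longleftrightarrow>
    j < b \<and> D i j = (int k - int f) mod int v \<and> c = (int k + int f) mod int v"
proof -
  have inj: "inj_on (D i) {..<b}" using D assms by (auto simp: NHSLR_def)
  have [simp]: "(i * v + f) div v = i" "f mod v = f" using assms by auto
  show ?thesis
    using inj by (auto simp: NHSLR_array_def Let_def inj_on_eq_iff image_iff Bex_def split: if_splits)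
qed

lemma array_eq_None_iff:
  assumes "i < g" "f < v"
  shows "NHSLR_array v b D (i * v + f) k = None \<longleftrightarrow> (int k - int f) mod int v \<notin> D i ` {..<b}"
  using assms by (auto simp: NHSLR_array_def Let_def)

text \<open>Used to recover \<open>k\<close> and \<open>f\<close> from \<open>k + f\<close> and
  \<open>k - f\<close>: adding and subtracting yields their doubles, and 2 is invertible modulo
  \<open>v\<close>.\<close>

lemma residue_unique:
  fixes x y :: nat
  assumes "x < v" "y < v" "[2 * int x = 2 * int y] (mod int v)"
  shows "x = y"
proof -
  have "[int x = int y] (mod int v)"
    using assms(3) v_odd by (subst (asm) cong_mult_lcancel) (auto simp: coprime_commute)
  then show ?thesis using assms by (simp add: cong_int_iff cong_less_modulus_unique_nat)
qed

text \<open>In column \<open>k\<close> the non-star cells correspond to the cells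
  \<open>(i, j)\<close> of the rectangle, through the residue \<open>f = k - D i j\<close>. Hence
  \<open>g * b\<close> of the \<open>g * v\<close> rows carry symbols.\<close>

lemma array_row_count:
  assumes "k < v"
  shows "card {r. r < g * v \<and> NHSLR_array v b D r k = None} = g * (v - b)"
proof -
  let ?A = "{r. r < g * v \<and> NHSLR_array v b D r k \<noteq> None}"
  define h where "h = (\<lambda>(i, j). i * v + nat ((int k - D i j) mod int v))"
  have res: "nat ((int k - D i j) mod int v) < v" for i j
    using v_pos by (simp add: nat_less_iff)
  have range: "0 \<le> D i j \<and> D i j < int v" if "i < g" "j < b" for i j
    using D that by (auto simp: NHSLR_def)
  have inverse: "(int k - int (nat ((int k - D i j) mod int v))) mod int v = D i j"
    if "i < g" "j < b" for i j
    using range[OF that] v_pos by (simp add: mod_simps)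
  have "inj_on h ({..<g} \<times> {..<b})"
  proof (intro inj_onI, clarsimp simp: h_def)
    fix i j i' j'
    assume ij: "i < g" "j < b" "i' < g" "j' < b"
      and eq: "i * v + nat ((int k - D i j) mod int v) = i' * v + nat ((int k - D i' j') mod int v)"
    have "(i * v + nat ((int k - D i j) mod int v)) div v = i" for i j
      using res[of i j] v_pos by simp
    then have "i = i'" using eq by metis
    moreover from this have "D i j = D i j'"
      using eq inverse[of i j] inverse[of i j'] ij by simp
    ultimately show "i = i' \<and> j = j'"
      using D ij by (auto simp: NHSLR_def inj_on_def)
  qed
  moreover have "h ` ({..<g} \<times> {..<b}) = ?A"
  proof (intro equalityI subsetI)
    fix r assume "r \<in> h ` ({..<g} \<times> {..<b})"
    then obtain i j where ij: "i < g" "j < b" and r: "r = i * v + nat ((int k - D i j) mod int v)"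
      by (auto simp: h_def)
    have "r < Suc i * v" using r res[of i j] by simp
    also have "\<dots> \<le> g * v" using ij by (intro mult_right_mono) auto
    finally show "r \<in> ?A"
      using array_eq_None_iff[OF ij(1) res[of i j], of k] inverse[OF ij] r ij by auto
  next
    fix r assume "r \<in> ?A"
    moreover from this obtain i f where r: "r = i * v + f" "i < g" "f < v"
      by (auto elim: less_mult_pairE)
    ultimately obtain j where "j < b" and j: "(int k - int f) mod int v = D i j"
      using array_eq_None_iff[OF r(2,3), of k] by (auto simp del: not_None_eq)
    have "(int k - D i j) mod int v = int f"
      using r unfolding j[symmetric] by (simp add: mod_simps)
    then show "r \<in> h ` ({..<g} \<times> {..<b})"
      using r \<open>j < b\<close> by (auto simp: h_def intro!: image_eqI[of _ _ "(i, j)"])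
  qed
  ultimately have "card ?A = g * b"
    using card_image by (fastforce simp: card_cartesian_product)
  moreover have "{r. r < g * v \<and> NHSLR_array v b D r k = None} = {..<g * v} - ?A"
    by (simp add: set_eq_iff del: not_None_eq cong: conj_cong)
  moreover have "card ({..<g * v} - ?A) = card {..<g * v} - card ?A"
    by (intro card_Diff_subset) auto
  ultimately show ?thesis by (simp add: diff_mult_distrib2)
qed

text \<open>Each rectangle row \<open>i\<close> yields exactly one cell with symbol
  \<open>(c, j)\<close>: the equations \<open>k + f = c\<close> and \<open>k - f = D i j\<close>
  have a unique solution modulo the odd number \<open>v\<close>.\<close>

lemma array_positions_count:
  assumes "0 \<le> c" "c < int v" "j < b"
  shows "card {(r, k). r < g * v \<and> k < v \<and> NHSLR_array v b D r k = Some (c, j)} = g"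
    (is "card ?A = g")
proof -
  have inj: "inj_on (\<lambda>(r, k). r div v) ?A"
  proof (intro inj_onI, clarsimp)
    fix r k r' k'
    assume lt: "r < g * v" "r' < g * v" "k < v" "k' < v"
      and P: "NHSLR_array v b D r k = Some (c, j)" "NHSLR_array v b D r' k' = Some (c, j)"
      and eq: "r div v = r' div v"
    obtain i f where r: "r = i * v + f" "i < g" "f < v" using lt by (auto elim: less_mult_pairE)
    obtain i' f' where r': "r' = i' * v + f'" "i' < g" "f' < v" using lt by (auto elim: less_mult_pairE)
    have "i' = i" using eq r r' by simp
    have diff: "[int k - int f = int k' - int f'] (mod int v)"
      and sum: "[int k + int f = int k' + int f'] (mod int v)"
      using P r r' \<open>i' = i\<close> by (auto simp: array_eq_Some_iff cong_def)
    have "k = k'" using cong_add[OF diff sum] lt by (intro residue_unique) auto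
    moreover have "f = f'" using cong_diff[OF sum diff] r r' by (intro residue_unique) auto
    ultimately show "r = r' \<and> k = k'" using r r' \<open>i' = i\<close> by simp
  qed
  have image: "(\<lambda>(r, k). r div v) ` ?A = {..<g}"
  proof (intro equalityI subsetI)
    fix i assume "i \<in> {..<g}"
    then have i: "i < g" by simp
    \<comment> \<open>Half the sum and half the difference of \<open>c\<close> and
      \<open>D i j\<close> solve the two equations.\<close>
    define k where "k = nat (half_sum v c (D i j))"
    define f where "f = nat (half_sum v c (- D i j))"
    have hs: "0 \<le> half_sum v x y \<and> half_sum v x y < int v" for x y
      using v_pos by (simp add: half_sum_def)
    have lt: "k < v" "f < v" using hs by (auto simp: k_def f_def nat_less_iff)
    have k: "[2 * int k = c + D i j] (mod int v)" and f: "[2 * int f = c - D i j] (mod int v)"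
      using cong_double_half_sum[OF v_odd, of c "D i j"]
        cong_double_half_sum[OF v_odd, of c "- D i j"] hs by (auto simp: k_def f_def)
    have cancel: "[x = y] (mod int v)" if "[2 * x = 2 * y] (mod int v)" for x y
      using that v_odd by (subst (asm) cong_mult_lcancel) (auto simp: coprime_commute)
    have "[2 * (int k + int f) = 2 * c] (mod int v)" using cong_add[OF k f] by (simp add: algebra_simps)
    then have 1: "c = (int k + int f) mod int v"
      using cancel[of "int k + int f" c] assms by (simp add: cong_def)
    have "[2 * (int k - int f) = 2 * D i j] (mod int v)"
      using cong_diff[OF k f] by (simp add: algebra_simps)
    moreover have "0 \<le> D i j \<and> D i j < int v" using D i assms by (auto simp: NHSLR_def)
    ultimately have 2: "D i j = (int k - int f) mod int v"
      using cancel[of "int k - int f" "D i j"] by (simp add: cong_def)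
    have "NHSLR_array v b D (i * v + f) k = Some (c, j)"
      using array_eq_Some_iff[OF i lt(2)] 1 2 assms by simp
    moreover have "i * v + f < Suc i * v" using lt by simp
    then have "i * v + f < g * v"
      using i by (metis Suc_leI mult_le_mono1 order_less_le_trans)
    ultimately show "i \<in> (\<lambda>(r, k). r div v) ` ?A"
      using lt by (auto intro!: image_eqI[of _ _ "(i * v + f, k)"])
  qed (auto simp: less_mult_imp_div_less)
  show ?thesis using card_image[OF inj] unfolding image by simp
qed

lemma array_same_symbol:
  assumes lt: "r < g * v" "r' < g * v" "k < v" "k' < v" and neq: "(r, k) \<noteq> (r', k')"
    and P: "NHSLR_array v b D r k = Some (c, j)" "NHSLR_array v b D r' k' = Some (c, j)"
  shows "r \<noteq> r' \<and> k \<noteq> k' \<and> NHSLR_array v b D r k' = None \<and> NHSLR_array v b D r' k = None"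
proof -
  obtain i f where r: "r = i * v + f" "i < g" "f < v" using lt by (auto elim: less_mult_pairE)
  obtain i' f' where r': "r' = i' * v + f'" "i' < g" "f' < v" using lt by (auto elim: less_mult_pairE)
  have j: "j < b" and Dij: "D i j = (int k - int f) mod int v" "D i' j = (int k' - int f') mod int v"
    and c: "c = (int k + int f) mod int v" "c = (int k' + int f') mod int v"
    using P r r' by (auto simp: array_eq_Some_iff)
  have sum: "[int k + int f = int k' + int f'] (mod int v)" using c by (simp add: cong_def)
  \<comment> \<open>In a common rectangle row both the sum and the difference of column and residue
    would agree, forcing the two cells to coincide.\<close>
  have "i \<noteq> i'"
  proof
    assume "i = i'"
    then have diff: "[int k - int f = int k' - int f'] (mod int v)" using Dij by (simp add: cong_def)
    have "k = k'" using cong_add[OF diff sum] lt by (intro residue_unique) auto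
    moreover have "f = f'" using cong_diff[OF sum diff] r r' by (intro residue_unique) auto
    ultimately show False using neq r r' \<open>i = i'\<close> by simp
  qed
  \<comment> \<open>Twice the half-sum is congruent to the sum of the two differences, so cancelling
    2 identifies any \<open>x - y\<close> with that double. It is applied to both crossing
    cells.\<close>
  have half: "(x - y) mod int v = half_sum v (D i j) (D i' j)"
    if "[2 * (x - y) = (int k - int f) + (int k' - int f')] (mod int v)" for x y
  proof -
    have "[2 * half_sum v (D i j) (D i' j) = D i j + D i' j] (mod int v)"
      using v_odd by (rule cong_double_half_sum)
    also have "[D i j + D i' j = (int k - int f) + (int k' - int f')] (mod int v)"
      unfolding Dij by (simp add: cong_def mod_simps)
    also have "[(int k - int f) + (int k' - int f') = 2 * (x - y)] (mod int v)"
      using that by (rule cong_sym)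
    finally have "[half_sum v (D i j) (D i' j) = x - y] (mod int v)"
      using v_odd by (subst (asm) cong_mult_lcancel) (auto simp: coprime_commute)
    then show ?thesis by (simp add: cong_def half_sum_def)
  qed
  have not_in: "half_sum v (D i j) (D i' j) \<notin> D i ` {..<b} \<union> D i' ` {..<b}"
    using D r r' j \<open>i \<noteq> i'\<close> by (auto simp: NHSLR_def)
  have "int v dvd (int k + int f) - (int k' + int f')"
    using sum by (simp add: cong_iff_dvd_diff)
  then have "int v dvd - ((int k + int f) - (int k' + int f'))" by (simp only: dvd_minus_iff)
  \<comment> \<open>Both congruences restate \<open>k + f = k' + f'\<close> modulo \<open>v\<close>,
    with opposite signs, hence the negated divisibility.\<close>
  then have cross: "[2 * (int k' - int f) = (int k - int f) + (int k' - int f')] (mod int v)"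
    "[2 * (int k - int f') = (int k - int f) + (int k' - int f')] (mod int v)"
    using \<open>int v dvd (int k + int f) - (int k' + int f')\<close>
    by (simp_all add: cong_iff_dvd_diff algebra_simps)
  \<comment> \<open>Equal columns force equal residues by the common sum, and then column
    \<open>j\<close> of the rectangle would repeat an entry.\<close>
  have "k \<noteq> k'"
  proof
    assume "k = k'"
    then have "[int f = int f'] (mod int v)" using sum by (simp add: cong_add_lcancel)
    then have "f = f'" using r r' by (simp add: cong_int_iff cong_less_modulus_unique_nat)
    then have "D i j = D i' j" using Dij \<open>k = k'\<close> by simp
    then show False using D j r r' \<open>i \<noteq> i'\<close> by (auto simp: NHSLR_def inj_on_def)
  qed
  moreover have "r div v = i" "r' div v = i'" using r r' by auto
  then have "r \<noteq> r'" using \<open>i \<noteq> i'\<close> by auto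
  moreover have "NHSLR_array v b D r k' = None" "NHSLR_array v b D r' k = None"
    using half[OF cross(1)] half[OF cross(2)] not_in r r' by (simp_all add: array_eq_None_iff)
  ultimately show ?thesis by simp
qed

lemma NHSLR_pda: "pda v (g * v) (g * (v - b)) ({0..<int v} \<times> {..<b}) (NHSLR_array v b D)"
proof
  fix r k s assume *: "r < g * v" "k < v" "NHSLR_array v b D r k = Some s"
  obtain i f where "r = i * v + f" "i < g" "f < v" using * by (auto elim: less_mult_pairE)
  then show "s \<in> {0..<int v} \<times> {..<b}"
    using * v_pos by (cases s) (auto simp: array_eq_Some_iff)
next
  fix s assume "s \<in> {0..<int v} \<times> {..<b}"
  then obtain c j where s: "s = (c, j)" "0 \<le> c" "c < int v" "j < b" by auto
  have "g > 0" using D by (simp add: NHSLR_def)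
  then have "{(r, k). r < g * v \<and> k < v \<and> NHSLR_array v b D r k = Some (c, j)} \<noteq> {}"
    using array_positions_count[OF s(2-4)] by (metis card.empty less_numeral_extra(3))
  then show "\<exists>r<g * v. \<exists>k<v. NHSLR_array v b D r k = Some s" using s by auto
next
  fix r r' k k' s
  assume "r < g * v" "r' < g * v" "k < v" "k' < v" "(r, k) \<noteq> (r', k')"
    "NHSLR_array v b D r k = Some s" "NHSLR_array v b D r' k' = Some s"
  then show "r \<noteq> r' \<and> k \<noteq> k' \<and> NHSLR_array v b D r k' = None \<and> NHSLR_array v b D r' k = None"
    using array_same_symbol by (cases s) blast
qed (rule array_row_count)

section \<open>Parameters of the scheme from a rectangle\<close>

lemma NHSLR_coded_caching:
  assumes "N > 0"
  shows "\<exists>(M::real) cache send.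
     coded_caching_scheme (g * v) v M N cache send \<and>
     M / real N = 1 - real b / real v \<and>
     coded_caching_gain (g * v) v N cache send g \<and>
     load (g * v) v N send = real b / real g"
proof -
  interpret pda v "g * v" "g * (v - b)" "{0..<int v} \<times> {..<b}" "NHSLR_array v b D"
    by (rule NHSLR_pda)
  have "g > 0" using D by (simp add: NHSLR_def)
  have "inj_on (D 0) {..<b}" "D 0 ` {..<b} \<subseteq> {0..<int v}"
    using D \<open>g > 0\<close> by (auto simp: NHSLR_def)
  \<comment> \<open>The entries of one rectangle row are distinct residues. This makes the
    natural-number subtraction \<open>v - b\<close> exact in the memory ratio.\<close>
  then have "b \<le> v" using card_inj_on_le[of "D 0" "{..<b}" "{0..<int v}"] by simp
  \<comment> \<open>Listing each symbol once gives \<open>v * b\<close> transmissions, so division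
    by \<open>g * v\<close> packets per file yields the load \<open>b / g\<close>.\<close>
  obtain ss where ss: "set ss = {0..<int v} \<times> {..<b}" "distinct ss"
    using finite_distinct_list[of "{0..<int v} \<times> {..<b}"] by auto
  have len: "length ss = v * b"
    using distinct_card[OF ss(2)] ss(1) by (simp add: card_cartesian_product)
  let ?M = "real N * (real (g * (v - b)) / real (g * v))"
  let ?send = "\<lambda>d. map (coded d) ss"
  have "coded_caching_scheme (g * v) v ?M N (cached N) ?send"
    using \<open>g > 0\<close> v_pos assms ss by (intro scheme) auto
  moreover have "?M / real N = 1 - real b / real v"
    using \<open>g > 0\<close> v_pos assms \<open>b \<le> v\<close> by (simp add: of_nat_diff diff_divide_distrib)
  moreover have "coded_caching_gain (g * v) v N (cached N) ?send g"
    using ss array_positions_count by (intro gain) (auto simp: positions_def)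
  moreover have "load (g * v) v N ?send = real b / real g"
    using load_constant[OF assms, of v ?send "v * b"] len v_pos by simp
  ultimately show ?thesis by blast
qed

end

theorem theorem3:
  fixes n v :: nat and m :: "nat \<Rightarrow> nat"
  assumes "n > 0"
    and "\<And>i. i \<in> {1..n} \<Longrightarrow> m i > 0"
    and "odd v"
    and "v \<ge> (\<Prod>i=1..n. m i + 1)"
  shows "(\<exists>D. NHSLR v (2 ^ n) (\<Prod>i=1..n. m i) D) \<and>
    (\<forall>N::nat. N > 0 \<longrightarrow>
      (\<exists>(M::real) cache send.
         coded_caching_scheme (2 ^ n * v) v M N cache send \<and>
         M / real N = 1 - real (\<Prod>i=1..n. m i) / real v \<and>
         coded_caching_gain (2 ^ n * v) v N cache send (2 ^ n) \<and>
         load (2 ^ n * v) v N send = real (\<Prod>i=1..n. m i) / 2 ^ n))"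
proof -
  obtain D where D: "NHSLR v (2 ^ n) (\<Prod>i=1..n. m i) D"
    using NHSLR_exists assms(2-4) by blast
  have "real (2 ^ n) = 2 ^ n" by simp
  then show ?thesis using D NHSLR_coded_caching[OF D] by metis
qed

end
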